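(* Let $n\ge 0$ and $\lambda_0,\dots,\lambda_n\in\mathbb{C}$, and let $\Phi_{(\lambda_0,\dots,\lambda_n)}$ be the fundamental function. Then $\Phi^{(k)}_{(\lambda_0,\dots,\lambda_n)}(0)=0$ for $k=0,\dots,n-1$, and for every integer $k\ge n$ $$\Phi^{(k)}_{(\lambda_0,\dots,\lambda_n)}(0)=\sum_{\substack{s_0,\dots,s_n\ge 0\\ s_0+\dots+s_n+n=k}}\lambda_0^{s_0}\cdots\lambda_n^{s_n}.$$ In particular, $\Phi^{(n)}_{(\lambda_0,\dots,\lambda_n)}(0)=1$, $\Phi^{(n+1)}_{(\lambda_0,\dots,\lambda_n)}(0)=\lambda_0+\dots+\lambda_n$, and $$\Phi^{(n+2)}_{(\lambda_0,\dots,\lambda_n)}(0)=\sum_{\substack{s_0,\dots,s_n\ge 0\\ s_0+\dots+s_n=2}}\lambda_0^{s_0}\cdots\lambda_n^{s_n}.$$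
   Context: For $\lambda_0,\dots,\lambda_n\in\mathbb{C}$ (repetitions allowed) the fundamental function is defined by $$\Phi_{(\lambda_0,\dots,\lambda_n)}(x):=\frac{1}{2\pi i}\int_{\Gamma_r}\frac{e^{xz}}{(z-\lambda_0)\cdots(z-\lambda_n)}\,dz,$$ where $\Gamma_r(t)=re^{it}$, $t\in[0,2\pi]$, and $r>0$ is so large that all $\lambda_j$ lie inside the circle. The sums run over nonnegative integers $s_0,\dots,s_n$, with the convention $0^0=1$. *)

theory Defs
  imports "HOL-Complex_Analysis.Complex_Analysis"
begin

text \<open>
  The fundamental function of \<open>\<lambda>\<^sub>0, \<dots>, \<lambda>\<^sub>n\<close> (given by \<open>lam 0, \<dots>, lam n\<close>; other values of \<open>lam\<close>
  are irrelevant), with the radius \<open>r\<close> of the integration circle explicit. It is only meaningful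
  if all \<open>lam j\<close>, \<open>j \<le> n\<close>, lie inside the circle, in which case it does not depend on \<open>r\<close>.
\<close>

definition fundamental_fun :: "real \<Rightarrow> nat \<Rightarrow> (nat \<Rightarrow> complex) \<Rightarrow> complex \<Rightarrow> complex" where
  "fundamental_fun r n lam x =
     1 / (2 * of_real pi * \<i>) *
       contour_integral (circlepath 0 r) (\<lambda>z. exp (x * z) / (\<Prod>j\<le>n. z - lam j))"

end

(* Differentiating under the integral sign, the k-th derivative at 0 is the normalised integral of
   z^k / ((z - lam 0) ... (z - lam n)) over the circle of radius r. The inversion w = 1/z
   turns this into the integral of F(w) / w^(k+1) over the circle of radius 1/r, where
   F(w) = w^n / ((1 - lam 0 w) ... (1 - lam n w)) is holomorphic inside since the norms of
   the lam j are less than r. By Cauchy's formula the value is the k-th Taylor coefficient of F,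
   which is read off from the product of geometric series. *)
theory Submission
  imports Defs
begin

text \<open>The library formula \<open>fps_prod_nth'\<close> sums over multisets of size
  \<open>m\<close> with elements in \<open>A\<close>. Such a multiset is determined by its
  multiplicities, that is, by an exponent tuple with sum \<open>m\<close>. Extensional functions
  represent each tuple exactly once.\<close>

lemma fps_prod_nth_PiE:
  fixes F :: "'a \<Rightarrow> 'b :: comm_ring_1 fps"
  assumes "finite A"
  shows "fps_nth (\<Prod>x\<in>A. F x) m =
    (\<Sum>s | s \<in> A \<rightarrow>\<^sub>E (UNIV :: nat set) \<and> sum s A = m. \<Prod>x\<in>A. fps_nth (F x) (s x))"
proof -
  have count: "count (\<Sum>x\<in>A. replicate_mset (s x) x) y = (if y \<in> A then s y else 0)" for s y
    using assms by (simp add: count_sum)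
  have "(\<Sum>s | s \<in> A \<rightarrow>\<^sub>E (UNIV :: nat set) \<and> sum s A = m. \<Prod>x\<in>A. fps_nth (F x) (s x)) =
        (\<Sum>X\<in>multisets_of_size A m. \<Prod>x\<in>A. fps_nth (F x) (count X x))"
  proof (rule sum.reindex_bij_witness
      [of _ "\<lambda>X. restrict (count X) A" "\<lambda>s. \<Sum>x\<in>A. replicate_mset (s x) x"])
    fix s assume s: "s \<in> {s. s \<in> A \<rightarrow>\<^sub>E (UNIV :: nat set) \<and> sum s A = m}"
    have "restrict (count (\<Sum>x\<in>A. replicate_mset (s x) x)) A = restrict s A"
      by (rule restrict_ext) (simp add: count)
    \<comment> \<open>Multiplicities only recover \<open>s\<close> on \<open>A\<close>;
      extensionality settles the values elsewhere.\<close>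
    also have "\<dots> = s"
      using s by (auto intro: PiE_restrict)
    finally show "restrict (count (\<Sum>x\<in>A. replicate_mset (s x) x)) A = s" .
    show "(\<Sum>x\<in>A. replicate_mset (s x) x) \<in> multisets_of_size A m"
      using s assms by (auto simp: multisets_of_size_def set_mset_sum split: if_splits)
    show "(\<Prod>x\<in>A. fps_nth (F x) (count (\<Sum>x\<in>A. replicate_mset (s x) x) x)) =
          (\<Prod>x\<in>A. fps_nth (F x) (s x))"
      by (simp add: count)
  next
    fix X assume X: "X \<in> multisets_of_size A m"
    then have sub: "set_mset X \<subseteq> A" and size: "size X = m"
      by (auto simp: multisets_of_size_def)
    show "(\<Sum>x\<in>A. replicate_mset (restrict (count X) A x) x) = X"
      using sub by (intro multiset_eqI) (auto simp: count not_in_iff)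
    have "sum (count X) A = m"
      using sub assms size
      by (simp add: size_multiset_overloaded_eq sum.mono_neutral_right not_in_iff)
    then show "restrict (count X) A \<in> {s. s \<in> A \<rightarrow>\<^sub>E (UNIV :: nat set) \<and> sum s A = m}"
      by simp
  qed
  with fps_prod_nth'[OF assms] show ?thesis
    by metis
qed

lemma fps_prod_nth_0:
  "fps_nth (\<Prod>x\<in>A. F x) 0 = (\<Prod>x\<in>A. fps_nth (F x :: 'a :: comm_ring_1 fps) 0)"
  by (induction A rule: infinite_finite_induct) auto

text \<open>To reach degree 1, exactly one factor supplies its linear coefficient and all others
  their constant coefficient 1.\<close>

lemma fps_prod_nth_1:
  fixes F :: "'a \<Rightarrow> 'b :: comm_ring_1 fps"
  assumes "finite A" "\<And>x. x \<in> A \<Longrightarrow> fps_nth (F x) 0 = 1"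
  shows "fps_nth (\<Prod>x\<in>A. F x) (Suc 0) = (\<Sum>x\<in>A. fps_nth (F x) (Suc 0))"
  using assms
  by (induction A rule: finite_induct) (simp_all add: fps_mult_nth_1 fps_prod_nth_0 add.commute)

text \<open>Multiplying the geometric series by \<open>1 - fps_const a * fps_X\<close> telescopes to
  1, so the series is the formal inverse. The case \<open>a = 0\<close> is covered because
  \<open>0 ^ 0 = 1\<close>.\<close>

lemma has_fps_expansion_geometric:
  fixes a :: "'a :: {banach, real_normed_field}"
  shows "(\<lambda>w. 1 / (1 - a * w)) has_fps_expansion Abs_fps (\<lambda>m. a ^ m)"
proof -
  have "Abs_fps (\<lambda>m. a ^ m) * (1 - fps_const a * fps_X) = 1"
  proof (rule fps_ext)
    fix m
    show "fps_nth (Abs_fps (\<lambda>m. a ^ m) * (1 - fps_const a * fps_X)) m = fps_nth 1 m"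
      by (cases m) (simp_all add: right_diff_distrib fps_X_mult_right_nth flip: mult.assoc)
  qed
  then have "inverse (1 - fps_const a * fps_X) = Abs_fps (\<lambda>m. a ^ m)"
    by (metis fps_inverse_unique mult.commute)
  moreover have "(\<lambda>w. inverse (1 - a * w)) has_fps_expansion inverse (1 - fps_const a * fps_X)"
    by (intro fps_expansion_intros) auto
  ultimately show ?thesis
    by (simp add: divide_inverse)
qed

text \<open>Under \<open>w = 1 / z\<close> we get \<open>dw = - dz / z^2\<close>, and the image
  circle is traversed backwards; the two signs cancel.\<close>

lemma has_contour_integral_circlepath_inversion:
  assumes "(g has_contour_integral I) (circlepath 0 (1 / r))" "r > 0"
  shows "((\<lambda>z. g (1 / z) / z\<^sup>2) has_contour_integral I) (circlepath 0 r)"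
proof -
  \<comment> \<open>\<open>c\<close> runs once around the unit circle, so inverting a point of it
    amounts to the reflection of the parameter \<open>t\<close> to \<open>1 - t\<close>.\<close>
  define c where "c t = exp (2 * of_real pi * \<i> * of_real t)" for t :: real
  have c_minus: "c (1 - t) = 1 / c t" for t
    by (simp add: c_def right_diff_distrib exp_diff)
  have c_nz: "c t \<noteq> 0" for t
    by (simp add: c_def)
  have path: "circlepath 0 s t = s * c t" for s t
    by (simp add: circlepath c_def)
  have deriv: "vector_derivative (circlepath 0 s) (at t) = 2 * pi * \<i> * s * c t" for s t
    by (simp add: vector_derivative_circlepath c_def)
  define h where "h t = g (of_real (1 / r) * c t) * (2 * pi * \<i> * of_real (1 / r) * c t)" for t
  have "(h has_integral I) (cbox 0 1)"
    using assms(1) unfolding has_contour_integral path deriv h_def by simp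
  \<comment> \<open>The reflection maps the unit interval onto itself with scaling factor 1 in
    absolute value, so the integral keeps its value and its sign.\<close>
  from has_integral_affinity[OF this, of "-1" 1]
  have "((\<lambda>t. h (1 - t)) has_integral I) {0..1}"
    by (simp add: image_affinity_atLeastAtMost_diff)
  also have "(\<lambda>t. h (1 - t)) =
      (\<lambda>t. g (1 / (r * c t)) / (r * c t)\<^sup>2 * (2 * pi * \<i> * r * c t))"
    using \<open>r > 0\<close> c_nz by (simp add: h_def c_minus power2_eq_square fun_eq_iff)
  finally show ?thesis
    unfolding has_contour_integral path deriv .
qed

text \<open>The Leibniz rule on the parameter interval applies, since the
  \<open>x\<close>-derivative of the integrand is jointly continuous in \<open>x\<close> and
  \<open>t\<close>. Differentiating \<open>exp (x * z)\<close> brings down a factor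
  \<open>z\<close>.\<close>

lemma has_field_derivative_contour_integral_exp:
  assumes "continuous_on (sphere 0 r) g" "r \<ge> 0"
  shows "((\<lambda>x. contour_integral (circlepath 0 r) (\<lambda>z. exp (x * z) * g z)) has_field_derivative
           contour_integral (circlepath 0 r) (\<lambda>z. exp (x * z) * (z * g z))) (at x)"
proof -
  let ?\<gamma> = "circlepath 0 r"
  let ?d = "\<lambda>t. vector_derivative ?\<gamma> (at t)"
  have cont_\<gamma>: "continuous_on {0..1} ?\<gamma>"
    using path_circlepath path_def by blast
  have sphere: "?\<gamma> ` {0..1} \<subseteq> sphere 0 r"
    using \<open>r \<ge> 0\<close> by (metis path_image_circlepath path_image_def order_refl abs_of_nonneg)
  have cont_g: "continuous_on {0..1} (\<lambda>t. g (?\<gamma> t))"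
    using continuous_on_compose2[OF assms(1) cont_\<gamma> sphere] .
  have cont_d: "continuous_on {0..1} ?d"
    unfolding vector_derivative_circlepath by (intro continuous_intros)
  \<comment> \<open>Lifts continuity in the curve parameter to joint continuity in \<open>x\<close>
    and the parameter.\<close>
  have snd: "continuous_on (UNIV \<times> cbox 0 1) (\<lambda>p :: complex \<times> real. f (snd p))"
    if "continuous_on {0..1} f" for f :: "real \<Rightarrow> complex"
    by (rule continuous_on_compose2[OF that continuous_on_snd[OF continuous_on_id]]) auto
  have "((\<lambda>x. integral (cbox 0 1) (\<lambda>t. exp (x * ?\<gamma> t) * g (?\<gamma> t) * ?d t)) has_field_derivative
           integral (cbox 0 1) (\<lambda>t. exp (x * ?\<gamma> t) * (?\<gamma> t * g (?\<gamma> t)) * ?d t)) (at x within UNIV)"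
  proof (rule leibniz_rule_field_derivative)
    show "((\<lambda>x. exp (x * ?\<gamma> t) * g (?\<gamma> t) * ?d t) has_field_derivative
            exp (x * ?\<gamma> t) * (?\<gamma> t * g (?\<gamma> t)) * ?d t) (at x within UNIV)" for x t
      by (auto intro!: derivative_eq_intros)
    show "(\<lambda>t. exp (x * ?\<gamma> t) * g (?\<gamma> t) * ?d t) integrable_on cbox 0 1" for x
      using cont_\<gamma> cont_g cont_d by (intro integrable_continuous continuous_intros) auto
    show "continuous_on (UNIV \<times> cbox 0 1)
            (\<lambda>(x, t). exp (x * ?\<gamma> t) * (?\<gamma> t * g (?\<gamma> t)) * ?d t)"
      unfolding case_prod_unfold
      by (intro continuous_intros snd cont_\<gamma> cont_g cont_d)
  qed auto
  then show ?thesis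
    by (simp add: contour_integral_integral)
qed

text \<open>Each derivative absorbs one more \<open>z\<close> into the weight, which stays
  continuous on the circle. The equation is between functions, not values at 0, so that it can be
  differentiated again; \<open>c\<close> stands for the normalising factor.\<close>

lemma higher_deriv_contour_integral_exp:
  assumes "continuous_on (sphere 0 r) g" "r \<ge> 0"
  shows "(deriv ^^ k) (\<lambda>x. c * contour_integral (circlepath 0 r) (\<lambda>z. exp (x * z) * g z)) =
           (\<lambda>x. c * contour_integral (circlepath 0 r) (\<lambda>z. exp (x * z) * (z ^ k * g z)))"
proof (induction k)
  case (Suc k)
  have "continuous_on (sphere 0 r) (\<lambda>z. z ^ k * g z)"
    using assms(1) by (intro continuous_intros)
  from has_field_derivative_contour_integral_exp[OF this \<open>r \<ge> 0\<close>]
  show ?case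
    by (auto simp: Suc fun_eq_iff mult.assoc intro!: DERIV_imp_deriv DERIV_cmult)
qed auto

lemma higher_deriv_fundamental_fun:
  assumes "r > 0" and lam: "\<And>j. j \<le> n \<Longrightarrow> norm (lam j) < r"
  shows "(deriv ^^ k) (fundamental_fun r n lam) 0 =
           fps_nth (fps_X ^ n * (\<Prod>j\<le>n. Abs_fps (\<lambda>m. lam j ^ m))) k"
proof -
  define F where "F w = w ^ n * (\<Prod>j\<le>n. 1 / (1 - lam j * w))" for w
  have F_expansion: "F has_fps_expansion fps_X ^ n * (\<Prod>j\<le>n. Abs_fps (\<lambda>m. lam j ^ m))"
    unfolding F_def
    by (intro has_fps_expansion_mult has_fps_expansion_prod has_fps_expansion_geometric
        has_fps_expansion_fps_X_power)
  \<comment> \<open>The poles \<open>1 / lam j\<close> of \<open>F\<close> lie outside the closed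
    disc, so Cauchy's formula may be used on its boundary circle.\<close>
  have nz: "1 - lam j * w \<noteq> 0" if "j \<le> n" "w \<in> cball 0 (1 / r)" for j w
  proof -
    have "norm (lam j * w) \<le> norm (lam j) * (1 / r)"
      unfolding norm_mult using that by (intro mult_left_mono) auto
    also have "\<dots> < 1"
      using lam[OF that(1)] \<open>r > 0\<close> by simp
    finally show ?thesis
      by auto
  qed
  have "F holomorphic_on cball 0 (1 / r)"
    unfolding F_def by (intro holomorphic_intros) (use nz in auto)
  then have "((\<lambda>w. F w / (w - 0) ^ Suc k) has_contour_integral
      (2 * pi * \<i>) / fact k * (deriv ^^ k) F 0) (circlepath 0 (1 / r))"
    using \<open>r > 0\<close>
    by (intro Cauchy_has_contour_integral_higher_derivative_circlepath)
       (auto intro: holomorphic_on_imp_continuous_on elim: holomorphic_on_subset)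
  from has_contour_integral_circlepath_inversion[OF this \<open>r > 0\<close>]
  have "((\<lambda>z. F (1 / z) / (1 / z) ^ Suc k / z\<^sup>2) has_contour_integral
      (2 * pi * \<i>) / fact k * (deriv ^^ k) F 0) (circlepath 0 r)"
    by simp
  then have "contour_integral (circlepath 0 r) (\<lambda>z. F (1 / z) / (1 / z) ^ Suc k / z\<^sup>2) =
      (2 * pi * \<i>) / fact k * (deriv ^^ k) F 0"
    by (rule contour_integral_unique)
  also have "contour_integral (circlepath 0 r) (\<lambda>z. F (1 / z) / (1 / z) ^ Suc k / z\<^sup>2) =
      contour_integral (circlepath 0 r) (\<lambda>z. z ^ k * (1 / (\<Prod>j\<le>n. z - lam j)))"
  proof (rule contour_integral_cong)
    fix z assume "z \<in> path_image (circlepath 0 r)"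
    then have "z \<noteq> 0"
      using \<open>r > 0\<close> by auto
    then have "(\<Prod>j\<le>n. 1 / (1 - lam j * (1 / z))) = (\<Prod>j\<le>n. z / (z - lam j))"
      by (intro prod.cong) (auto simp: field_simps)
    \<comment> \<open>The \<open>n + 1\<close> factors contribute \<open>z ^ (n + 1)\<close>, and
      the factor \<open>w ^ n\<close> of \<open>F\<close> cancels all but one \<open>z\<close>. With
      \<open>z ^ Suc k / z^2\<close> this leaves \<open>z ^ k\<close>.\<close>
    then have "F (1 / z) = z * (1 / (\<Prod>j\<le>n. z - lam j))"
      using \<open>z \<noteq> 0\<close> by (simp add: F_def prod_dividef power_divide)
    then show "F (1 / z) / (1 / z) ^ Suc k / z\<^sup>2 = z ^ k * (1 / (\<Prod>j\<le>n. z - lam j))"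
      using \<open>z \<noteq> 0\<close> by (simp add: power_divide power2_eq_square)
  qed auto
  finally have moment: "1 / (2 * pi * \<i>) *
      contour_integral (circlepath 0 r) (\<lambda>z. z ^ k * (1 / (\<Prod>j\<le>n. z - lam j))) =
      (deriv ^^ k) F 0 / fact k"
    by simp
  have "continuous_on (sphere 0 r) (\<lambda>z. 1 / (\<Prod>j\<le>n. z - lam j))"
    using lam by (intro continuous_intros) (fastforce simp: prod_zero_iff)
  \<comment> \<open>At \<open>x = 0\<close> the exponential is 1, leaving the moment computed
    above.\<close>
  from higher_deriv_contour_integral_exp[OF this, of k "1 / (2 * pi * \<i>)"] \<open>r > 0\<close>
  have "(deriv ^^ k) (fundamental_fun r n lam) 0 = 1 / (2 * pi * \<i>) *
      contour_integral (circlepath 0 r) (\<lambda>z. z ^ k * (1 / (\<Prod>j\<le>n. z - lam j)))"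
    by (simp add: fundamental_fun_def [abs_def])
  also note moment
  finally show ?thesis
    using fps_nth_fps_expansion[OF F_expansion] by simp
qed

theorem proposition3:
  fixes n :: nat and lam :: "nat \<Rightarrow> complex" and r :: real
  assumes "r > 0" and "\<And>j. j \<le> n \<Longrightarrow> norm (lam j) < r"
  shows "(\<forall>k<n. (deriv ^^ k) (fundamental_fun r n lam) 0 = 0)
    \<and> (\<forall>k\<ge>n. (deriv ^^ k) (fundamental_fun r n lam) 0
          = (\<Sum>s | s \<in> {..n} \<rightarrow>\<^sub>E (UNIV :: nat set) \<and> (\<Sum>j\<le>n. s j) + n = k.
               \<Prod>j\<le>n. lam j ^ s j))
    \<and> (deriv ^^ n) (fundamental_fun r n lam) 0 = 1
    \<and> (deriv ^^ (n + 1)) (fundamental_fun r n lam) 0 = (\<Sum>j\<le>n. lam j)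
    \<and> (deriv ^^ (n + 2)) (fundamental_fun r n lam) 0
          = (\<Sum>s | s \<in> {..n} \<rightarrow>\<^sub>E (UNIV :: nat set) \<and> (\<Sum>j\<le>n. s j) = 2.
               \<Prod>j\<le>n. lam j ^ s j)"
proof -
  define P where "P = (\<Prod>j\<le>n. Abs_fps (\<lambda>m. lam j ^ m))"
  \<comment> \<open>The factor \<open>fps_X ^ n\<close> shifts the coefficients of \<open>P\<close>
    by \<open>n\<close>, which gives the vanishing below order \<open>n\<close>.\<close>
  have deriv: "(deriv ^^ k) (fundamental_fun r n lam) 0 =
      (if k < n then 0 else fps_nth P (k - n))" for k
    using assms by (simp add: higher_deriv_fundamental_fun fps_X_power_mult_nth P_def)
  have P: "fps_nth P m = (\<Sum>s | s \<in> {..n} \<rightarrow>\<^sub>E (UNIV :: nat set) \<and> (\<Sum>j\<le>n. s j) = m.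
      \<Prod>j\<le>n. lam j ^ s j)" for m
    by (simp add: P_def fps_prod_nth_PiE)
  have "(deriv ^^ k) (fundamental_fun r n lam) 0 =
      (\<Sum>s | s \<in> {..n} \<rightarrow>\<^sub>E (UNIV :: nat set) \<and> (\<Sum>j\<le>n. s j) + n = k. \<Prod>j\<le>n. lam j ^ s j)"
    if "k \<ge> n" for k
  proof -
    have "(\<Sum>j\<le>n. s j) + n = k \<longleftrightarrow> (\<Sum>j\<le>n. s j) = k - n" for s :: "nat \<Rightarrow> nat"
      using that by auto
    then show ?thesis
      using that by (simp add: deriv P)
  qed
  \<comment> \<open>Orders \<open>n\<close> and \<open>n + 1\<close> use the constant and linear
    coefficients of \<open>P\<close> directly, so no tuples have to be enumerated.\<close>
  moreover have "(deriv ^^ n) (fundamental_fun r n lam) 0 = 1"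
    unfolding deriv by (simp add: P_def fps_prod_nth_0)
  moreover have "(deriv ^^ (n + 1)) (fundamental_fun r n lam) 0 = (\<Sum>j\<le>n. lam j)"
    unfolding deriv by (simp add: P_def fps_prod_nth_1)
  moreover have "(deriv ^^ (n + 2)) (fundamental_fun r n lam) 0 =
      (\<Sum>s | s \<in> {..n} \<rightarrow>\<^sub>E (UNIV :: nat set) \<and> (\<Sum>j\<le>n. s j) = 2. \<Prod>j\<le>n. lam j ^ s j)"
    unfolding deriv P by simp
  moreover have "(deriv ^^ k) (fundamental_fun r n lam) 0 = 0" if "k < n" for k
    using that by (simp add: deriv)
  ultimately show ?thesis
    by blast
qed

end
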